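(* Let $d\ge 1$, let $\mathcal{H}_d$ be a $d$-dimensional complex Hilbert space, and let $k\in\{1,\dots,d\}$. Let $\Phi:B(\mathcal{H}_d)\to B(\mathcal{H}_d)$ be a linear map that is $k$-positive, unital, trace-preserving, and satisfies $$\Delta_k\big(\Phi_k(X)^*\Phi_k(X)\big)\le \Delta_k(X^*X)\qquad\text{for all } X\in M_k(B(\mathcal{H}_d)),$$ where $\Phi_k=\mathrm{id}_k\otimes\Phi$. If $a\in\mathbb{R}$ satisfies $$0\le a\le \frac{d}{kd+1},$$ then the map $\Lambda^-_a:B(\mathcal{H}_d)\to B(\mathcal{H}_d)$ defined by $$\Lambda^-_a(X)=\frac{1}{d-a}\big(\mathrm{Tr}(X)\,\mathbf{1}_d-a\,\Phi(X)\big)$$ is a $k$-Kadison--Schwarz operator.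
   Context: $B(\mathcal{H}_d)$ is the algebra of linear operators on $\mathcal{H}_d$, $\mathbf{1}_d$ is its identity, and $M_k(B(\mathcal{H}_d))=M_k\otimes B(\mathcal{H}_d)$. For a linear map $\Phi$ on $B(\mathcal{H}_d)$, $\Phi_k:=\mathrm{id}_k\otimes\Phi$ acts on $M_k(B(\mathcal{H}_d))$ (entrywise application of $\Phi$). $\Phi$ is $k$-positive if $\Phi_k$ maps positive semidefinite elements to positive semidefinite elements. $\Phi$ is unital if $\Phi(\mathbf{1}_d)=\mathbf{1}_d$ and trace-preserving if $\mathrm{Tr}\,\Phi(X)=\mathrm{Tr}\,X$ for all $X$. The map $\Delta(X)=\frac1d \mathrm{Tr}(X)\,\mathbf{1}_d$ is the completely depolarizing map and $\Delta_k:=\mathrm{id}_k\otimes\Delta$, i.e. $\Delta_k(X)=\frac1d\,(\mathrm{Tr}_2X)\otimes\mathbf{1}_d$, where $\mathrm{Tr}_2(M\otimes Y)=M\,\mathrm{Tr}\,Y$. A unital linear map $\Psi:B(\mathcal{H}_d)\to B(\mathcal{H}_d)$ is a $k$-Kadison--Schwarz ($k$-KS) operator if $\Psi_k(X^*X)\ge\Psi_k(X)^*\Psi_k(X)$ for all $X\in M_k(B(\mathcal{H}_d))$. Inequalities between operators are in the positive semidefinite order. *)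

theory Defs
  imports "HOL-Analysis.Analysis"
begin

text \<open>
  The space \<open>H_d\<close> is \<open>complex^'d\<close> with its standard inner product and \<open>d = CARD('d)\<close>, and
  \<open>B(H_d)\<close> is the type of matrices \<open>complex^'d^'d\<close> (entry in row \<open>p\<close>, column \<open>q\<close> is
  \<open>A $ p $ q\<close>) with product \<open>**\<close>; note that \<open>*\<close> on this type is the entrywise product.
  The algebra \<open>M_k(B(H_d))\<close>, \<open>k = CARD('k)\<close>, is the type of matrices indexed by
  \<open>'k \<times> 'd\<close>, via \<open>(M \<otimes> Y) $ (i,p) $ (j,q) = M $ i $ j * Y $ p $ q\<close>.
  As index types are finite and nonempty, \<open>d \<ge> 1\<close> and \<open>k \<ge> 1\<close> hold automatically.
\<close>

type_synonym 'n cmat = "complex^'n^'n"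

definition mscale :: "complex \<Rightarrow> ('n::finite) cmat \<Rightarrow> 'n cmat"  (infixr \<open>*\<^sub>M\<close> 75)
  where "c *\<^sub>M A = map_matrix (\<lambda>z. c * z) A"

lemma vector_space_mscale: "vector_space ((*\<^sub>M) :: complex \<Rightarrow> ('n::finite) cmat \<Rightarrow> 'n cmat)"
  by unfold_locales (simp_all add: mscale_def vec_eq_iff algebra_simps)

definition conj_transpose :: "('n::finite) cmat \<Rightarrow> 'n cmat"
  where "conj_transpose A = map_matrix cnj (transpose A)"

definition psd :: "('n::finite) cmat \<Rightarrow> bool"
  where "psd A \<longleftrightarrow> (\<forall>v::complex^'n. (\<Sum>i\<in>UNIV. cnj (v $ i) * (A *v v) $ i) \<in> \<real>\<^sub>\<ge>\<^sub>0)"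

text \<open>
  The positive semidefinite order; the order \<open>\<le>\<close> that the library puts on vectors is
  componentwise and is not used.
\<close>

definition psd_le :: "('n::finite) cmat \<Rightarrow> 'n cmat \<Rightarrow> bool"  (infix \<open>\<preceq>\<close> 50)
  where "A \<preceq> B \<longleftrightarrow> psd (B - A)"

abbreviation complex_linear :: "(('n::finite) cmat \<Rightarrow> ('m::finite) cmat) \<Rightarrow> bool"
  where "complex_linear \<equiv> Vector_Spaces.linear (*\<^sub>M) (*\<^sub>M)"

definition unital :: "(('d::finite) cmat \<Rightarrow> 'd cmat) \<Rightarrow> bool"
  where "unital \<Phi> \<longleftrightarrow> \<Phi> (mat 1) = mat 1"

definition trace_preserving :: "(('d::finite) cmat \<Rightarrow> 'd cmat) \<Rightarrow> bool"
  where "trace_preserving \<Phi> \<longleftrightarrow> (\<forall>X. trace (\<Phi> X) = trace X)"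

definition block :: "('k::finite \<times> 'd::finite) cmat \<Rightarrow> 'k \<Rightarrow> 'k \<Rightarrow> 'd cmat"
  where "block X i j = (\<chi> p q. X $ (i, p) $ (j, q))"

text \<open>
  \<open>ampl \<Phi>\<close> is \<open>id_k \<otimes> \<Phi>\<close>; the value of \<open>k\<close> is determined by the type of its argument.
\<close>

definition ampl ::
    "(('d::finite) cmat \<Rightarrow> 'd cmat) \<Rightarrow> ('k::finite \<times> 'd) cmat \<Rightarrow> ('k \<times> 'd) cmat"
  where "ampl \<Phi> X = (\<chi> r s. \<Phi> (block X (fst r) (fst s)) $ snd r $ snd s)"

text \<open>
  The parameter \<open>k\<close> of the next two notions is passed as \<open>TYPE('k)\<close> with \<open>CARD('k) = k\<close>.
\<close>

definition k_positive :: "('k::finite) itself \<Rightarrow> (('d::finite) cmat \<Rightarrow> 'd cmat) \<Rightarrow> bool"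
  where "k_positive K \<Phi> \<longleftrightarrow> (\<forall>X :: ('k \<times> 'd) cmat. psd X \<longrightarrow> psd (ampl \<Phi> X))"

definition k_Kadison_Schwarz ::
    "('k::finite) itself \<Rightarrow> (('d::finite) cmat \<Rightarrow> 'd cmat) \<Rightarrow> bool"
  where "k_Kadison_Schwarz K \<Psi> \<longleftrightarrow> complex_linear \<Psi> \<and> unital \<Psi> \<and>
    (\<forall>X :: ('k \<times> 'd) cmat.
      conj_transpose (ampl \<Psi> X) ** ampl \<Psi> X \<preceq> ampl \<Psi> (conj_transpose X ** X))"

definition depolarizing :: "('d::finite) cmat \<Rightarrow> 'd cmat"
  where "depolarizing X = (1 / of_nat CARD('d) * trace X) *\<^sub>M mat 1"

definition Lambda_minus ::
    "real \<Rightarrow> (('d::finite) cmat \<Rightarrow> 'd cmat) \<Rightarrow> 'd cmat \<Rightarrow> 'd cmat"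
  where "Lambda_minus a \<Phi> X =
    complex_of_real (1 / (real CARD('d) - a)) *\<^sub>M
      (trace X *\<^sub>M mat 1 - complex_of_real a *\<^sub>M \<Phi> X)"

end

theory Submission
  imports Defs
begin

text \<open>
  Write \<open>T(X) = Tr\<^sub>2(X) \<otimes> \<one>\<close> on \<open>M\<^sub>k(B(H\<^sub>d))\<close> and \<open>s = d - a > 0\<close>, so that the amplification of
  \<open>\<Lambda>\<^sup>-\<^sub>a\<close> is \<open>X \<mapsto> (T(X) - a \<Phi>\<^sub>k(X)) / s\<close>. The proof rests on two facts.

  The first is the reduction inequality \<open>Y \<le> k T(Y)\<close> for positive semidefinite \<open>Y\<close>
  (\<open>reduction_psd\<close>), which holds because vectors of \<open>\<complex>\<^sup>k \<otimes> \<complex>\<^sup>d\<close> have Schmidt rank at most \<open>k\<close>.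

  The second is that the Kadison--Schwarz deficit of a unital map does not change when an element
  of \<open>M\<^sub>k \<otimes> \<one>\<close> is added to \<open>X\<close> (\<open>Kadison_Schwarz_deficit_shift\<close>); it needs the map to commute
  with the adjoint, which a \<open>k\<close>-positive unital \<open>\<Phi>\<close> does by polarization
  (\<open>k_positive_conj_transpose\<close>). Subtracting \<open>Tr\<^sub>2(X) \<otimes> \<one> / d\<close> from \<open>X\<close> leaves an element \<open>Z\<close>
  with \<open>T(Z) = 0\<close>, and for \<open>Z\<close> the deficit is
  \<open>(T(Z\<^sup>*Z) - a \<Phi>\<^sub>k(Z\<^sup>*Z)) / s - (a\<^sup>2 / s\<^sup>2) \<Phi>\<^sub>k(Z)\<^sup>*\<Phi>\<^sub>k(Z)\<close>.

  Since \<open>\<Phi>\<close> is \<open>k\<close>-positive and trace-preserving, \<open>\<Phi>\<^sub>k(Z\<^sup>*Z) \<le> k T(\<Phi>\<^sub>k(Z\<^sup>*Z)) = k T(Z\<^sup>*Z)\<close>. By the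
  hypothesis on \<open>\<Delta>\<^sub>k\<close>, also \<open>\<Phi>\<^sub>k(Z)\<^sup>*\<Phi>\<^sub>k(Z) \<le> k T(\<Phi>\<^sub>k(Z)\<^sup>*\<Phi>\<^sub>k(Z)) \<le> k T(Z\<^sup>*Z)\<close>. Hence the deficit is
  at least \<open>1 / s - a k / s - a\<^sup>2 k / s\<^sup>2 = (d - a (k d + 1)) / s\<^sup>2\<close> times \<open>T(Z\<^sup>*Z) \<ge> 0\<close>, and this
  coefficient is nonnegative exactly when \<open>a \<le> d / (k d + 1)\<close>.
\<close>

lemma sum_in_nonneg_Reals:
  fixes f :: "'i \<Rightarrow> complex"
  assumes "\<And>i. i \<in> I \<Longrightarrow> f i \<in> \<real>\<^sub>\<ge>\<^sub>0"
  shows "sum f I \<in> \<real>\<^sub>\<ge>\<^sub>0"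
  using assms by (induction I rule: infinite_finite_induct) (auto intro: nonneg_Reals_add_I)

lemma half_in_nonneg_Reals:
  fixes z :: complex
  assumes "2 * z \<in> \<real>\<^sub>\<ge>\<^sub>0"
  shows "z \<in> \<real>\<^sub>\<ge>\<^sub>0"
  using assms by (auto simp: complex_nonneg_Reals_iff)

section \<open>Matrix algebra\<close>

lemma mscale_nth [simp]: "(c *\<^sub>M A) $ i $ j = c * A $ i $ j"
  by (simp add: mscale_def)

lemma conj_transpose_nth [simp]: "conj_transpose A $ i $ j = cnj (A $ j $ i)"
  by (simp add: conj_transpose_def transpose_def)

lemma mscale_mscale: "b *\<^sub>M (c *\<^sub>M A) = (b * c) *\<^sub>M A"
  and mscale_diff_right: "c *\<^sub>M (A - B) = c *\<^sub>M A - c *\<^sub>M B"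
  by (simp_all add: vec_eq_iff algebra_simps)

lemma mscale_mult_left: "(c *\<^sub>M A) ** B = c *\<^sub>M (A ** B)"
  and mscale_mult_right: "A ** (c *\<^sub>M B) = c *\<^sub>M (A ** B)"
  by (simp_all add: vec_eq_iff matrix_matrix_mult_def sum_distrib_left mult_ac)

lemma conj_transpose_add: "conj_transpose (A + B) = conj_transpose A + conj_transpose B"
  and conj_transpose_mscale: "conj_transpose (c *\<^sub>M A) = cnj c *\<^sub>M conj_transpose A"
  and conj_transpose_mat_1: "conj_transpose (mat 1) = mat 1"
  by (simp_all add: vec_eq_iff matrix_matrix_mult_def mat_def mult_ac)

lemma trace_add_complex: "trace (A + B) = trace A + trace (B :: ('n::finite) cmat)"
  and trace_mscale: "trace (c *\<^sub>M A) = c * trace (A :: ('n::finite) cmat)"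
  by (simp_all add: trace_def sum.distrib sum_distrib_left)

lemma complex_linearI:
  fixes \<Phi> :: "('n::finite) cmat \<Rightarrow> ('m::finite) cmat"
  assumes "\<And>A B. \<Phi> (A + B) = \<Phi> A + \<Phi> B" and "\<And>c A. \<Phi> (c *\<^sub>M A) = c *\<^sub>M \<Phi> A"
  shows "complex_linear \<Phi>"
  unfolding Vector_Spaces.linear_def module_hom_def module_hom_axioms_def
  using assms vector_space_mscale
  by (simp add: module_iff_vector_space vector_space_mscale)

lemma complex_linear_add: "complex_linear \<Phi> \<Longrightarrow> \<Phi> (A + B) = \<Phi> A + \<Phi> B"
  and complex_linear_mscale: "complex_linear \<Phi> \<Longrightarrow> \<Phi> (c *\<^sub>M A) = c *\<^sub>M \<Phi> A"
  by (simp_all add: Vector_Spaces.linear_def module_hom_def module_hom_axioms_def)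

lemma complex_linear_sum:
  assumes "complex_linear \<Phi>"
  shows "\<Phi> (\<Sum>i\<in>I. f i) = (\<Sum>i\<in>I. \<Phi> (f i))"
proof -
  have "\<Phi> 0 = 0"
    using complex_linear_add[OF assms, of 0 0] by simp
  then show ?thesis
    by (induction I rule: infinite_finite_induct) (simp_all add: complex_linear_add[OF assms])
qed

lemma matrix_add_rdistrib: "((A + B) :: ('n::finite) cmat) ** C = A ** C + B ** C"
  by (simp add: vec_eq_iff matrix_matrix_mult_def algebra_simps sum.distrib)

section \<open>Positive semidefinite matrices\<close>

text \<open>The sesquilinear form \<open>u\<^sup>* A v\<close>.\<close>

definition sesq :: "('n::finite) cmat \<Rightarrow> complex^'n \<Rightarrow> complex^'n \<Rightarrow> complex"
  where "sesq A u v = (\<Sum>i\<in>UNIV. cnj (u $ i) * (A *v v) $ i)"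

lemma sesq_eq_double_sum: "sesq A u v = (\<Sum>i\<in>UNIV. \<Sum>j\<in>UNIV. cnj (u $ i) * A $ i $ j * v $ j)"
  by (simp add: sesq_def matrix_vector_mult_def sum_distrib_left mult_ac)

lemma psd_iff_sesq: "psd A \<longleftrightarrow> (\<forall>v. sesq A v v \<in> \<real>\<^sub>\<ge>\<^sub>0)"
  by (simp add: psd_def sesq_def)

lemma sesq_add: "sesq A (u + u') v = sesq A u v + sesq A u' v"
  "sesq A u (v + v') = sesq A u v + sesq A u v'"
  by (simp_all add: sesq_eq_double_sum algebra_simps sum.distrib)

lemma sesq_diff: "sesq A (u - u') v = sesq A u v - sesq A u' v"
  "sesq A u (v - v') = sesq A u v - sesq A u v'"
  by (simp_all add: sesq_eq_double_sum algebra_simps sum_subtractf)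

lemma sesq_zero: "sesq A 0 v = 0" "sesq A u 0 = 0"
  by (simp_all add: sesq_eq_double_sum)

lemma sesq_sum: "sesq A (sum f I) v = (\<Sum>i\<in>I. sesq A (f i) v)"
  "sesq A u (sum f I) = (\<Sum>i\<in>I. sesq A u (f i))"
  by (induction I rule: infinite_finite_induct) (simp_all add: sesq_zero sesq_add)

lemma sesq_axis: "sesq A (axis p a) (axis q b) = cnj a * A $ p $ q * b"
proof -
  have "sesq A (axis p a) (axis q b)
      = (\<Sum>i\<in>UNIV. \<Sum>j\<in>UNIV. if i = p then (if j = q then cnj a * A $ p $ q * b else 0) else 0)"
    unfolding sesq_eq_double_sum by (intro sum.cong refl) (simp add: axis_def)
  also have "\<dots> = (\<Sum>i\<in>UNIV. if i = p then cnj a * A $ p $ q * b else 0)"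
    by (intro sum.cong refl) simp
  finally show ?thesis by simp
qed

lemma sesq_matrix_add: "sesq (A + B) u v = sesq A u v + sesq B u v"
  and sesq_matrix_diff: "sesq (A - B) u v = sesq A u v - sesq B u v"
  and sesq_matrix_mscale: "sesq (c *\<^sub>M A) u v = c * sesq A u v"
  by (simp_all add: sesq_eq_double_sum algebra_simps sum.distrib sum_subtractf sum_distrib_left)

lemma psd_add: "psd A \<Longrightarrow> psd B \<Longrightarrow> psd (A + B)"
  by (simp add: psd_iff_sesq sesq_matrix_add nonneg_Reals_add_I)

lemma psd_mscale: "psd A \<Longrightarrow> 0 \<le> c \<Longrightarrow> psd (complex_of_real c *\<^sub>M A)"
  by (simp add: psd_iff_sesq sesq_matrix_mscale nonneg_Reals_mult_I)

lemma psd_conj_transpose_mult: "psd (conj_transpose A ** A)"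
  unfolding psd_iff_sesq
proof
  fix v
  have "sesq (conj_transpose A ** A) v v
      = (\<Sum>i\<in>UNIV. \<Sum>j\<in>UNIV. \<Sum>l\<in>UNIV. cnj (A $ l $ i * v $ i) * (A $ l $ j * v $ j))"
    unfolding sesq_eq_double_sum matrix_matrix_mult_def
    by (simp add: sum_distrib_left sum_distrib_right mult_ac)
  also have "\<dots> = (\<Sum>i\<in>UNIV. \<Sum>l\<in>UNIV. \<Sum>j\<in>UNIV. cnj (A $ l $ i * v $ i) * (A $ l $ j * v $ j))"
    by (intro sum.cong refl sum.swap)
  also have "\<dots> = (\<Sum>l\<in>UNIV. \<Sum>i\<in>UNIV. \<Sum>j\<in>UNIV. cnj (A $ l $ i * v $ i) * (A $ l $ j * v $ j))"
    by (rule sum.swap)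
  also have "\<dots> = (\<Sum>l\<in>UNIV. cnj ((A *v v) $ l) * (A *v v) $ l)"
    by (simp add: matrix_vector_mult_def sum_product)
  also have "\<dots> \<in> \<real>\<^sub>\<ge>\<^sub>0"
    by (intro sum_in_nonneg_Reals) (simp add: complex_nonneg_Reals_iff)
  finally show "sesq (conj_transpose A ** A) v v \<in> \<real>\<^sub>\<ge>\<^sub>0" .
qed

lemma psd_hermitian:
  assumes "psd A"
  shows "conj_transpose A = A"
proof -
  have "cnj (A $ j $ i) = A $ i $ j" for i j
  proof -
    have real: "Im (sesq A v v) = 0" for v
      using assms by (auto simp: psd_iff_sesq complex_nonneg_Reals_iff)
    have diag: "Im (A $ p $ p) = 0" for p
      using real[of "axis p 1"] by (simp add: sesq_axis)
    have "Im (A $ i $ j) + Im (A $ j $ i) = 0"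
      using real[of "axis i 1 + axis j 1"] diag by (simp add: sesq_add sesq_axis)
    moreover have "Re (A $ i $ j) - Re (A $ j $ i) = 0"
      using real[of "axis i 1 + axis j \<i>"] diag by (simp add: sesq_add sesq_axis)
    ultimately show ?thesis by (simp add: complex_eq_iff)
  qed
  then show ?thesis by (simp add: vec_eq_iff)
qed

text \<open>
  The Cauchy--Schwarz inequality for the number of summands; the difference of the two sides is
  \<open>\<Sum>\<^sub>l\<^sub>,\<^sub>m (u\<^sub>l - u\<^sub>m)\<^sup>* A (u\<^sub>l - u\<^sub>m) / 2\<close>.
\<close>

lemma psd_sesq_sum_le:
  fixes u :: "'k::finite \<Rightarrow> complex^('n::finite)"
  assumes "psd A"
  shows "of_nat CARD('k) * (\<Sum>l\<in>UNIV. sesq A (u l) (u l)) - sesq A (\<Sum>l\<in>UNIV. u l) (\<Sum>l\<in>UNIV. u l)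
    \<in> \<real>\<^sub>\<ge>\<^sub>0"
proof (rule half_in_nonneg_Reals)
  let ?q = "\<lambda>l m. sesq A (u l) (u m)"
  have swap: "(\<Sum>l\<in>UNIV. \<Sum>m\<in>UNIV. ?q m l) = (\<Sum>l\<in>UNIV. \<Sum>m\<in>UNIV. ?q l m)"
    by (rule sum.swap)
  have "(\<Sum>l\<in>UNIV. \<Sum>m\<in>UNIV. sesq A (u l - u m) (u l - u m))
      = (\<Sum>l\<in>UNIV. \<Sum>m\<in>UNIV. ?q l l + ?q m m - ?q l m - ?q m l)"
    by (simp add: sesq_diff algebra_simps)
  also have "\<dots> = 2 * (of_nat CARD('k) * (\<Sum>l\<in>UNIV. ?q l l) - (\<Sum>l\<in>UNIV. \<Sum>m\<in>UNIV. ?q l m))"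
    by (simp add: sum.distrib sum_subtractf swap flip: sum_distrib_left)
  also have "(\<Sum>l\<in>UNIV. \<Sum>m\<in>UNIV. ?q l m) = sesq A (\<Sum>l\<in>UNIV. u l) (\<Sum>l\<in>UNIV. u l)"
    by (subst sesq_sum(1)) (simp add: sesq_sum(2))
  finally have "2 * (of_nat CARD('k) * (\<Sum>l\<in>UNIV. ?q l l) - sesq A (\<Sum>l\<in>UNIV. u l) (\<Sum>l\<in>UNIV. u l))
      = (\<Sum>l\<in>UNIV. \<Sum>m\<in>UNIV. sesq A (u l - u m) (u l - u m))" ..
  also have "\<dots> \<in> \<real>\<^sub>\<ge>\<^sub>0"
    using assms by (intro sum_in_nonneg_Reals) (simp add: psd_iff_sesq)
  finally show "2 * (of_nat CARD('k) * (\<Sum>l\<in>UNIV. ?q l l) - sesq A (\<Sum>l\<in>UNIV. u l) (\<Sum>l\<in>UNIV. u l))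
      \<in> \<real>\<^sub>\<ge>\<^sub>0" .
qed

text \<open>A positive semidefinite matrix is at most its trace times the identity.\<close>

lemma psd_sesq_le_trace:
  fixes A :: "('n::finite) cmat"
  assumes "psd A"
  shows "(\<Sum>p\<in>UNIV. cnj (g $ p) * g $ p) * trace A - sesq A g g \<in> \<real>\<^sub>\<ge>\<^sub>0"
proof (rule half_in_nonneg_Reals)
  let ?t = "\<lambda>p q. cnj (g $ p) * A $ p $ q * g $ q"
  let ?s = "\<lambda>p q. cnj (g $ p) * g $ p * A $ q $ q"
  \<comment> \<open>This family of vectors makes the sum of squares equal to twice the difference.\<close>
  let ?u = "\<lambda>p q. axis q (cnj (g $ p)) - axis p (cnj (g $ q))"
  have swap: "(\<Sum>p\<in>UNIV. \<Sum>q\<in>UNIV. ?t q p) = (\<Sum>p\<in>UNIV. \<Sum>q\<in>UNIV. ?t p q)"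
    "(\<Sum>p\<in>UNIV. \<Sum>q\<in>UNIV. ?s q p) = (\<Sum>p\<in>UNIV. \<Sum>q\<in>UNIV. ?s p q)"
    by (rule sum.swap)+
  have "(\<Sum>p\<in>UNIV. \<Sum>q\<in>UNIV. sesq A (?u p q) (?u p q))
      = (\<Sum>p\<in>UNIV. \<Sum>q\<in>UNIV. ?s p q + ?s q p - ?t q p - ?t p q)"
    by (intro sum.cong refl) (simp add: sesq_diff sesq_axis algebra_simps)
  also have "\<dots> = 2 * ((\<Sum>p\<in>UNIV. \<Sum>q\<in>UNIV. ?s p q) - (\<Sum>p\<in>UNIV. \<Sum>q\<in>UNIV. ?t p q))"
    by (simp only: sum.distrib sum_subtractf swap) simp
  also have "(\<Sum>p\<in>UNIV. \<Sum>q\<in>UNIV. ?s p q) = (\<Sum>p\<in>UNIV. cnj (g $ p) * g $ p) * trace A"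
    by (simp add: trace_def sum_product)
  also have "(\<Sum>p\<in>UNIV. \<Sum>q\<in>UNIV. ?t p q) = sesq A g g"
    by (simp add: sesq_eq_double_sum)
  finally have "2 * ((\<Sum>p\<in>UNIV. cnj (g $ p) * g $ p) * trace A - sesq A g g)
      = (\<Sum>p\<in>UNIV. \<Sum>q\<in>UNIV. sesq A (?u p q) (?u p q))" ..
  also have "\<dots> \<in> \<real>\<^sub>\<ge>\<^sub>0"
    using assms by (intro sum_in_nonneg_Reals) (simp add: psd_iff_sesq)
  finally show "2 * ((\<Sum>p\<in>UNIV. cnj (g $ p) * g $ p) * trace A - sesq A g g) \<in> \<real>\<^sub>\<ge>\<^sub>0" .
qed

section \<open>The reduction inequality\<close>

text \<open>The standard Hermitian inner product, conjugate-linear in the first argument.\<close>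

definition hinner :: "complex^('n::finite) \<Rightarrow> complex^'n \<Rightarrow> complex"
  where "hinner u v = (\<Sum>p\<in>UNIV. cnj (u $ p) * v $ p)"

lemma hinner_diff_sum_right:
  "hinner u (v - (\<Sum>l\<in>L. c l *s g l)) = hinner u v - (\<Sum>l\<in>L. c l * hinner u (g l))"
proof -
  have "hinner u (\<Sum>l\<in>L. c l *s g l) = (\<Sum>l\<in>L. c l * hinner u (g l))"
    unfolding hinner_def sum_component vector_smult_component sum_distrib_left
    by (subst sum.swap) (simp add: mult_ac)
  then show ?thesis
    by (simp add: hinner_def algebra_simps sum_subtractf)
qed

lemma hinner_commute: "hinner v u = cnj (hinner u v)"
  by (simp add: hinner_def mult.commute)

lemma hinner_self_eq_0: "hinner u u = 0 \<Longrightarrow> u = 0"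
proof -
  assume "hinner u u = 0"
  then have "Re (hinner u u) = 0" by simp
  then have "(\<Sum>p\<in>UNIV. (Re (u $ p))\<^sup>2 + (Im (u $ p))\<^sup>2) = 0"
    by (simp add: hinner_def power2_eq_square)
  then have "(Re (u $ p))\<^sup>2 + (Im (u $ p))\<^sup>2 = 0" for p
    by (subst (asm) sum_nonneg_eq_0_iff) auto
  then show "u = 0"
    by (simp add: vec_eq_iff complex_eq_iff)
qed

text \<open>
  Gram--Schmidt without normalization: linear dependence among the \<open>w\<close> only makes some \<open>g\<close>
  zero, so that the index set need not change.
\<close>

lemma orthogonal_family_exists:
  fixes w :: "'i \<Rightarrow> complex^('n::finite)"
  assumes "finite I"
  shows "\<exists>g c. (\<forall>l\<in>I. \<forall>m\<in>I. l \<noteq> m \<longrightarrow> hinner (g l) (g m) = 0) \<and>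
    (\<forall>i\<in>I. w i = (\<Sum>l\<in>I. c i l *s g l))"
  using assms
proof (induction I rule: finite_induct)
  case empty
  show ?case by simp
next
  case (insert x I)
  obtain g c where gc: "(\<forall>l\<in>I. \<forall>m\<in>I. l \<noteq> m \<longrightarrow> hinner (g l) (g m) = 0) \<and>
      (\<forall>i\<in>I. w i = (\<Sum>l\<in>I. c i l *s g l))"
    using insert.IH by (elim exE)
  then have orth: "hinner (g l) (g m) = 0" if "l \<in> I" "m \<in> I" "l \<noteq> m" for l m
    using that by simp
  have w: "w i = (\<Sum>l\<in>I. c i l *s g l)" if "i \<in> I" for i
    using gc that by blast
  define b where "b l = hinner (g l) (w x) / hinner (g l) (g l)" for l
  define h where "h = w x - (\<Sum>l\<in>I. b l *s g l)"
  define g' where "g' = g(x := h)"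
  define c' where
    "c' i l = (if i = x then if l = x then 1 else b l else if l = x then 0 else c i l)" for i l
  have h: "hinner (g m) h = 0" if "m \<in> I" for m
  proof -
    have "(\<Sum>l\<in>I. b l * hinner (g m) (g l)) = (\<Sum>l\<in>I. if l = m then b m * hinner (g m) (g m) else 0)"
      using orth that by (intro sum.cong refl) auto
    also have "\<dots> = b m * hinner (g m) (g m)"
      using insert.hyps that by simp
    \<comment> \<open>If \<open>g m = 0\<close>, the quotient \<open>b m\<close> is \<open>0\<close> by convention, and both sides vanish.\<close>
    also have "\<dots> = hinner (g m) (w x)"
      using hinner_self_eq_0[of "g m"] by (auto simp: b_def hinner_def)
    finally show ?thesis
      by (simp add: h_def hinner_diff_sum_right)
  qed
  have h': "hinner h (g m) = 0" if "m \<in> I" for m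
    using hinner_commute[of h "g m"] h[OF that] by simp
  have "hinner (g' l) (g' m) = 0" if "l \<in> insert x I" "m \<in> insert x I" "l \<noteq> m" for l m
    using that orth h h' by (auto simp: g'_def)
  moreover have "w i = (\<Sum>l\<in>insert x I. c' i l *s g' l)" if "i \<in> insert x I" for i
  proof -
    have "(\<Sum>l\<in>I. c' i l *s g' l) = (\<Sum>l\<in>I. (if i = x then b l else c i l) *s g l)"
      using insert.hyps by (intro sum.cong refl) (auto simp: c'_def g'_def)
    then show ?thesis
      using that insert.hyps w by (auto simp: c'_def g'_def h_def)
  qed
  ultimately show ?case by blast
qed

text \<open>The product vector \<open>f \<otimes> g\<close>.\<close>

definition tensor_vec :: "complex^('k::finite) \<Rightarrow> complex^('d::finite) \<Rightarrow> complex^('k \<times> 'd)"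
  where "tensor_vec f g = (\<chi> r. f $ fst r * g $ snd r)"

text \<open>The compression \<open>(f\<^sup>* \<otimes> \<one>) Y (f \<otimes> \<one>)\<close>.\<close>

definition compress :: "('k::finite \<times> 'd::finite) cmat \<Rightarrow> complex^'k \<Rightarrow> 'd cmat"
  where "compress Y f = (\<chi> p q. \<Sum>i\<in>UNIV. \<Sum>j\<in>UNIV. cnj (f $ i) * Y $ (i, p) $ (j, q) * f $ j)"

lemma sum_pairs: "(\<Sum>r\<in>UNIV. f r) = (\<Sum>i\<in>UNIV. \<Sum>p\<in>UNIV. f (i, p))"
  by (simp add: sum.cartesian_product)

lemma sesq_tensor_vec: "sesq Y (tensor_vec f g) (tensor_vec f g) = sesq (compress Y f) g g"
proof -
  let ?z = "\<lambda>i p j q. cnj (f $ i) * cnj (g $ p) * Y $ (i, p) $ (j, q) * (f $ j * g $ q)"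
  have "sesq Y (tensor_vec f g) (tensor_vec f g)
      = (\<Sum>i\<in>UNIV. \<Sum>p\<in>UNIV. \<Sum>j\<in>UNIV. \<Sum>q\<in>UNIV. ?z i p j q)"
    by (simp add: sesq_eq_double_sum sum_pairs tensor_vec_def)
  also have "\<dots> = (\<Sum>p\<in>UNIV. \<Sum>i\<in>UNIV. \<Sum>j\<in>UNIV. \<Sum>q\<in>UNIV. ?z i p j q)"
    by (rule sum.swap)
  also have "\<dots> = (\<Sum>p\<in>UNIV. \<Sum>i\<in>UNIV. \<Sum>q\<in>UNIV. \<Sum>j\<in>UNIV. ?z i p j q)"
    by (intro sum.cong refl sum.swap)
  also have "\<dots> = (\<Sum>p\<in>UNIV. \<Sum>q\<in>UNIV. \<Sum>i\<in>UNIV. \<Sum>j\<in>UNIV. ?z i p j q)"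
    by (intro sum.cong refl sum.swap)
  also have "\<dots> = sesq (compress Y f) g g"
    by (simp add: sesq_eq_double_sum compress_def sum_distrib_left sum_distrib_right mult_ac)
  finally show ?thesis .
qed

lemma psd_compress: "psd Y \<Longrightarrow> psd (compress Y f)"
  by (simp add: psd_iff_sesq flip: sesq_tensor_vec)

text \<open>The map \<open>X \<mapsto> Tr(X) \<one>\<close>; its amplification is \<open>X \<mapsto> Tr\<^sub>2(X) \<otimes> \<one>\<close>.\<close>

definition trace_one :: "('d::finite) cmat \<Rightarrow> 'd cmat"
  where "trace_one X = trace X *\<^sub>M mat 1"

lemma ampl_nth: "ampl \<Phi> X $ (i, p) $ (j, q) = \<Phi> (block X i j) $ p $ q"
  by (simp add: ampl_def)

lemma sesq_ampl_trace_one_tensor_vec: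
  fixes Y :: "('k::finite \<times> 'd::finite) cmat"
  shows "sesq (ampl trace_one Y) (tensor_vec f g) (tensor_vec f' g')
    = hinner g g' * (\<Sum>i\<in>UNIV. \<Sum>j\<in>UNIV. cnj (f $ i) * trace (block Y i j) * f' $ j)"
proof -
  have "sesq (ampl trace_one Y) (tensor_vec f g) (tensor_vec f' g')
      = (\<Sum>i\<in>UNIV. \<Sum>p\<in>UNIV. \<Sum>j\<in>UNIV. \<Sum>q\<in>UNIV.
          if p = q then cnj (f $ i) * cnj (g $ p) * trace (block Y i j) * (f' $ j * g' $ q) else 0)"
    unfolding sesq_eq_double_sum sum_pairs
    by (intro sum.cong refl) (simp add: tensor_vec_def ampl_nth trace_one_def mat_def)
  also have "\<dots> = (\<Sum>i\<in>UNIV. \<Sum>p\<in>UNIV. \<Sum>j\<in>UNIV.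
      cnj (f $ i) * cnj (g $ p) * trace (block Y i j) * (f' $ j * g' $ p))"
    by simp
  also have "\<dots> = (\<Sum>p\<in>UNIV. \<Sum>i\<in>UNIV. \<Sum>j\<in>UNIV.
      cnj (f $ i) * cnj (g $ p) * trace (block Y i j) * (f' $ j * g' $ p))"
    by (rule sum.swap)
  also have "\<dots> = hinner g g' * (\<Sum>i\<in>UNIV. \<Sum>j\<in>UNIV. cnj (f $ i) * trace (block Y i j) * f' $ j)"
    by (simp only: hinner_def sum_distrib_right) (simp add: sum_distrib_left mult_ac)
  finally show ?thesis .
qed

lemma trace_compress:
  "trace (compress Y f) = (\<Sum>i\<in>UNIV. \<Sum>j\<in>UNIV. cnj (f $ i) * trace (block Y i j) * f $ j)"
proof -
  have "trace (compress Y f)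
      = (\<Sum>p\<in>UNIV. \<Sum>i\<in>UNIV. \<Sum>j\<in>UNIV. cnj (f $ i) * Y $ (i, p) $ (j, p) * f $ j)"
    by (simp add: trace_def compress_def)
  also have "\<dots> = (\<Sum>i\<in>UNIV. \<Sum>p\<in>UNIV. \<Sum>j\<in>UNIV. cnj (f $ i) * Y $ (i, p) $ (j, p) * f $ j)"
    by (rule sum.swap)
  also have "\<dots> = (\<Sum>i\<in>UNIV. \<Sum>j\<in>UNIV. \<Sum>p\<in>UNIV. cnj (f $ i) * Y $ (i, p) $ (j, p) * f $ j)"
    by (intro sum.cong refl sum.swap)
  also have "\<dots> = (\<Sum>i\<in>UNIV. \<Sum>j\<in>UNIV. cnj (f $ i) * trace (block Y i j) * f $ j)"
    by (simp add: trace_def block_def sum_distrib_left sum_distrib_right)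
  finally show ?thesis .
qed

text \<open>
  The map \<open>X \<mapsto> k Tr(X) \<one> - X\<close> is \<open>k\<close>-positive. Every vector of \<open>\<complex>\<^sup>k \<otimes> \<complex>\<^sup>d\<close> is a sum of \<open>k\<close>
  product vectors \<open>f\<^sub>l \<otimes> g\<^sub>l\<close> with the \<open>g\<^sub>l\<close> orthogonal. On such a sum the form of
  \<open>Tr\<^sub>2(Y) \<otimes> \<one>\<close> is diagonal, and that of \<open>Y\<close> is at most \<open>k\<close> times its diagonal part.
\<close>

lemma reduction_psd:
  fixes Y :: "('k::finite \<times> 'd::finite) cmat"
  assumes "psd Y"
  shows "psd (of_nat CARD('k) *\<^sub>M ampl trace_one Y - Y)"
  unfolding psd_iff_sesq
proof
  fix w :: "complex^('k \<times> 'd)"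
  let ?T = "ampl trace_one Y"
  obtain g :: "'k \<Rightarrow> complex^'d" and c :: "'k \<Rightarrow> 'k \<Rightarrow> complex"
    where orth: "\<And>l m. l \<noteq> m \<Longrightarrow> hinner (g l) (g m) = 0"
      and w: "\<And>i. (\<chi> p. w $ (i, p)) = (\<Sum>l\<in>UNIV. c i l *s g l)"
    using orthogonal_family_exists[of "UNIV :: 'k set" "\<lambda>i. \<chi> p. w $ (i, p)"] by auto
  define f :: "'k \<Rightarrow> complex^'k" where "f l = (\<chi> i. c i l)" for l
  define u where "u l = tensor_vec (f l) (g l)" for l
  have w_sum: "w = (\<Sum>l\<in>UNIV. u l)"
  proof -
    have "w $ (i, p) = (\<Sum>l\<in>UNIV. c i l * g l $ p)" for i p
      using arg_cong[OF w[of i], of "\<lambda>v. v $ p"] by simp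
    then show ?thesis
      by (simp add: vec_eq_iff u_def f_def tensor_vec_def)
  qed
  have "sesq ?T w w = (\<Sum>l\<in>UNIV. \<Sum>m\<in>UNIV. sesq ?T (u l) (u m))"
    unfolding w_sum by (subst sesq_sum(1)) (simp add: sesq_sum(2))
  also have "\<dots> = (\<Sum>l\<in>UNIV. \<Sum>m\<in>UNIV.
      if m = l then hinner (g l) (g l) * trace (compress Y (f l)) else 0)"
    using orth
    by (intro sum.cong refl) (auto simp: u_def sesq_ampl_trace_one_tensor_vec trace_compress)
  also have "\<dots> = (\<Sum>l\<in>UNIV. hinner (g l) (g l) * trace (compress Y (f l)))"
    by simp
  finally have T: "sesq ?T w w = (\<Sum>l\<in>UNIV. hinner (g l) (g l) * trace (compress Y (f l)))" .
  have le_diag: "(\<Sum>l\<in>UNIV. hinner (g l) (g l) * trace (compress Y (f l)) - sesq Y (u l) (u l)) \<in> \<real>\<^sub>\<ge>\<^sub>0"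
    unfolding u_def sesq_tensor_vec hinner_def
    by (intro sum_in_nonneg_Reals psd_sesq_le_trace psd_compress assms)
  have "sesq (of_nat CARD('k) *\<^sub>M ?T - Y) w w
      = of_nat CARD('k) * (\<Sum>l\<in>UNIV. hinner (g l) (g l) * trace (compress Y (f l)) - sesq Y (u l) (u l))
        + (of_nat CARD('k) * (\<Sum>l\<in>UNIV. sesq Y (u l) (u l)) - sesq Y w w)"
    by (simp add: sesq_matrix_diff sesq_matrix_mscale T sum_subtractf algebra_simps)
  also have "\<dots> \<in> \<real>\<^sub>\<ge>\<^sub>0"
    using psd_sesq_sum_le[OF assms, of u] le_diag
    by (auto simp: w_sum intro!: nonneg_Reals_add_I nonneg_Reals_mult_I)
  finally show "sesq (of_nat CARD('k) *\<^sub>M ?T - Y) w w \<in> \<real>\<^sub>\<ge>\<^sub>0" .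
qed

lemma psd_ampl_trace_one:
  fixes Y :: "('k::finite \<times> 'd::finite) cmat"
  assumes "psd Y"
  shows "psd (ampl trace_one Y)"
proof -
  have "ampl trace_one Y = complex_of_real (1 / CARD('k)) *\<^sub>M
      ((of_nat CARD('k) *\<^sub>M ampl trace_one Y - Y) + Y)"
    by (simp add: vec_eq_iff)
  then show ?thesis
    using psd_mscale[OF psd_add[OF reduction_psd[OF assms] assms], of "1 / CARD('k)"] by simp
qed

section \<open>Amplifications\<close>

lemma block_add: "block (X + Y) i j = block X i j + block Y i j"
  and block_mscale: "block (c *\<^sub>M X) i j = c *\<^sub>M block X i j"
  by (simp_all add: vec_eq_iff block_def)

lemma block_eqI:
  assumes "\<And>i j. block X i j = block Y i j"
  shows "X = Y"
  using assms by (simp add: vec_eq_iff block_def)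

lemma block_ampl: "block (ampl \<Phi> X) i j = \<Phi> (block X i j)"
  by (simp add: vec_eq_iff block_def ampl_nth)

lemma ampl_add: "complex_linear \<Phi> \<Longrightarrow> ampl \<Phi> (X + Y) = ampl \<Phi> X + ampl \<Phi> Y"
  and ampl_mscale: "complex_linear \<Phi> \<Longrightarrow> ampl \<Phi> (c *\<^sub>M X) = c *\<^sub>M ampl \<Phi> X"
  by (simp_all add: vec_eq_iff ampl_nth block_add block_mscale complex_linear_add complex_linear_mscale)

text \<open>The element \<open>M \<otimes> \<one>\<close> of \<open>M\<^sub>k(B(H\<^sub>d))\<close>.\<close>

definition tensor_one :: "('k::finite) cmat \<Rightarrow> ('k \<times> 'd::finite) cmat"
  where "tensor_one M = (\<chi> r s. if snd r = snd s then M $ fst r $ fst s else 0)"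

lemma block_tensor_one: "block (tensor_one M) i j = M $ i $ j *\<^sub>M mat 1"
  by (simp add: vec_eq_iff block_def tensor_one_def mat_def)

lemma conj_transpose_tensor_one: "conj_transpose (tensor_one M) = tensor_one (conj_transpose M)"
  by (auto simp: vec_eq_iff tensor_one_def)

lemma mat_1_eq_tensor_one: "(mat 1 :: ('k::finite \<times> 'd::finite) cmat) = tensor_one (mat 1)"
  by (auto simp: vec_eq_iff mat_def tensor_one_def)

lemma block_tensor_one_mult:
  "block (tensor_one M ** X) i j = (\<Sum>l\<in>UNIV. M $ i $ l *\<^sub>M block X l j)"
proof -
  have "(tensor_one M ** X) $ (i, p) $ (j, q) = (\<Sum>l\<in>UNIV. M $ i $ l * X $ (l, p) $ (j, q))" for p q
  proof -
    have "(tensor_one M ** X) $ (i, p) $ (j, q)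
        = (\<Sum>l\<in>UNIV. \<Sum>s\<in>UNIV. if s = p then M $ i $ l * X $ (l, s) $ (j, q) else 0)"
      by (simp only: matrix_matrix_mult_def vec_lambda_beta sum_pairs)
        (intro sum.cong refl, auto simp: tensor_one_def)
    then show ?thesis by simp
  qed
  then show ?thesis by (simp add: vec_eq_iff block_def)
qed

lemma block_mult_tensor_one:
  "block (X ** tensor_one M) i j = (\<Sum>l\<in>UNIV. M $ l $ j *\<^sub>M block X i l)"
proof -
  have "(X ** tensor_one M) $ (i, p) $ (j, q) = (\<Sum>l\<in>UNIV. M $ l $ j * X $ (i, p) $ (l, q))" for p q
  proof -
    have "(X ** tensor_one M) $ (i, p) $ (j, q)
        = (\<Sum>l\<in>UNIV. \<Sum>s\<in>UNIV. if s = q then M $ l $ j * X $ (i, p) $ (l, s) else 0)"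
      by (simp only: matrix_matrix_mult_def vec_lambda_beta sum_pairs)
        (intro sum.cong refl, auto simp: tensor_one_def)
    then show ?thesis by simp
  qed
  then show ?thesis by (simp add: vec_eq_iff block_def)
qed

lemma ampl_tensor_one_mult:
  assumes "complex_linear \<Phi>"
  shows "ampl \<Phi> (tensor_one M ** X) = tensor_one M ** ampl \<Phi> X"
  by (rule block_eqI)
    (simp add: block_ampl block_tensor_one_mult complex_linear_sum[OF assms]
      complex_linear_mscale[OF assms])

lemma ampl_mult_tensor_one:
  assumes "complex_linear \<Phi>"
  shows "ampl \<Phi> (X ** tensor_one M) = ampl \<Phi> X ** tensor_one M"
  by (rule block_eqI)
    (simp add: block_ampl block_mult_tensor_one complex_linear_sum[OF assms]
      complex_linear_mscale[OF assms])

lemma ampl_tensor_one: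
  assumes "complex_linear \<Phi>" and "unital \<Phi>"
  shows "ampl \<Phi> (tensor_one M) = tensor_one M"
  using assms(2)
  by (intro block_eqI) (simp add: block_ampl block_tensor_one complex_linear_mscale[OF assms(1)] unital_def)

text \<open>
  Every \<open>X\<close> is a combination of \<open>\<one>\<close>, \<open>X\<^sup>*X\<close> and the positive elements \<open>(\<one> + X)\<^sup>*(\<one> + X)\<close> and
  \<open>(\<one> + \<i>X)\<^sup>*(\<one> + \<i>X)\<close>, whose images are Hermitian.
\<close>

lemma k_positive_conj_transpose:
  fixes X :: "('k::finite \<times> 'd::finite) cmat"
  assumes lin: "complex_linear \<Phi>" and pos: "k_positive TYPE('k) \<Phi>" and unital: "unital \<Phi>"
  shows "ampl \<Phi> (conj_transpose X) = conj_transpose (ampl \<Phi> X)"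
proof -
  let ?F = "ampl \<Phi> :: ('k \<times> 'd) cmat \<Rightarrow> _"
  have herm: "conj_transpose (?F (conj_transpose Y ** Y)) = ?F (conj_transpose Y ** Y)" for Y
    using pos psd_conj_transpose_mult psd_hermitian unfolding k_positive_def by blast
  have one: "?F (mat 1) = mat 1"
    unfolding mat_1_eq_tensor_one by (rule ampl_tensor_one[OF lin unital])
  have sum: "conj_transpose (?F Y) + conj_transpose (?F (conj_transpose Y))
      = ?F Y + ?F (conj_transpose Y)" for Y
  proof -
    have "conj_transpose (mat 1 + Y) ** (mat 1 + Y)
        = mat 1 + (Y + (conj_transpose Y + conj_transpose Y ** Y))"
      by (simp add: conj_transpose_add conj_transpose_mat_1 matrix_add_ldistrib
          matrix_add_rdistrib algebra_simps)
    with herm[of "mat 1 + Y"] show ?thesis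
      by (simp add: ampl_add[OF lin] one conj_transpose_add conj_transpose_mat_1 herm algebra_simps)
  qed
  have "cnj (?F X $ s $ r) = ?F (conj_transpose X) $ r $ s" for r s
  proof -
    have "cnj (?F X $ s $ r) + cnj (?F (conj_transpose X) $ s $ r)
        = ?F X $ r $ s + ?F (conj_transpose X) $ r $ s"
      using arg_cong[OF sum[of X], of "\<lambda>A. A $ r $ s"] by simp
    moreover have "- \<i> * cnj (?F X $ s $ r) + \<i> * cnj (?F (conj_transpose X) $ s $ r)
        = \<i> * ?F X $ r $ s - \<i> * ?F (conj_transpose X) $ r $ s"
      using arg_cong[OF sum[of "\<i> *\<^sub>M X"], of "\<lambda>A. A $ r $ s"]
      by (simp add: conj_transpose_mscale ampl_mscale[OF lin])
    ultimately show ?thesis by (simp add: complex_eq_iff)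
  qed
  then show ?thesis by (simp add: vec_eq_iff)
qed

section \<open>The Kadison--Schwarz inequality\<close>

text \<open>
  The Kadison--Schwarz deficit \<open>\<Psi>\<^sub>k(X\<^sup>*X) - \<Psi>\<^sub>k(X)\<^sup>*\<Psi>\<^sub>k(X)\<close> does not change when an element of
  \<open>M\<^sub>k \<otimes> \<one>\<close> is added to \<open>X\<close>, because \<open>\<Psi>\<^sub>k\<close> is a bimodule map over \<open>M\<^sub>k \<otimes> \<one>\<close>.
\<close>

lemma Kadison_Schwarz_deficit_shift:
  fixes Z :: "('k::finite \<times> 'd::finite) cmat"
  assumes lin: "complex_linear \<Psi>" and unital: "unital \<Psi>"
    and star: "ampl \<Psi> (conj_transpose Z) = conj_transpose (ampl \<Psi> Z)"
    and X: "X = Z + tensor_one M"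
  shows "ampl \<Psi> (conj_transpose X ** X) - conj_transpose (ampl \<Psi> X) ** ampl \<Psi> X
    = ampl \<Psi> (conj_transpose Z ** Z) - conj_transpose (ampl \<Psi> Z) ** ampl \<Psi> Z"
proof -
  let ?C = "tensor_one M :: ('k \<times> 'd) cmat"
  have expand: "conj_transpose (A + ?C) ** (A + ?C) = conj_transpose A ** A
      + (conj_transpose A ** ?C + (conj_transpose ?C ** A + conj_transpose ?C ** ?C))" for A
    by (simp add: conj_transpose_add matrix_add_ldistrib matrix_add_rdistrib algebra_simps)
  have "ampl \<Psi> (conj_transpose X ** X) = ampl \<Psi> (conj_transpose Z ** Z)
      + (conj_transpose (ampl \<Psi> Z) ** ?C
        + (conj_transpose ?C ** ampl \<Psi> Z + conj_transpose ?C ** ?C))"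
    unfolding X expand
    by (simp add: ampl_add[OF lin] conj_transpose_tensor_one ampl_tensor_one_mult[OF lin]
        ampl_mult_tensor_one[OF lin] ampl_tensor_one[OF lin unital] star)
  moreover have "ampl \<Psi> X = ampl \<Psi> Z + ?C"
    unfolding X by (simp add: ampl_add[OF lin] ampl_tensor_one[OF lin unital])
  ultimately show ?thesis
    by (simp add: expand)
qed

lemma ampl_depolarizing:
  fixes X :: "('k::finite \<times> 'd::finite) cmat"
  shows "ampl depolarizing X = complex_of_real (1 / real CARD('d)) *\<^sub>M ampl trace_one X"
  by (simp add: vec_eq_iff ampl_nth depolarizing_def trace_one_def)

lemma ampl_Lambda_minus:
  fixes X :: "('k::finite \<times> 'd::finite) cmat"
  shows "ampl (Lambda_minus a \<Phi>) X = complex_of_real (1 / (real CARD('d) - a)) *\<^sub>M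
    (ampl trace_one X - complex_of_real a *\<^sub>M ampl \<Phi> X)"
  by (simp add: vec_eq_iff ampl_nth Lambda_minus_def trace_one_def)

lemma ampl_trace_one_conj_transpose:
  "ampl trace_one (conj_transpose X) = conj_transpose (ampl trace_one X)"
  by (auto simp: vec_eq_iff ampl_nth trace_one_def mat_def trace_def block_def)

lemma ampl_trace_one_trace_preserving:
  assumes "trace_preserving \<Phi>"
  shows "ampl trace_one (ampl \<Phi> X) = ampl trace_one X"
  using assms by (intro block_eqI) (simp add: block_ampl trace_one_def trace_preserving_def)

lemma complex_linear_Lambda_minus:
  assumes "complex_linear \<Phi>"
  shows "complex_linear (Lambda_minus a \<Phi>)"
  by (rule complex_linearI)
    (simp_all add: Lambda_minus_def complex_linear_add[OF assms] complex_linear_mscale[OF assms]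
      trace_add_complex trace_mscale vec_eq_iff algebra_simps)

lemma unital_Lambda_minus:
  fixes \<Phi> :: "('d::finite) cmat \<Rightarrow> 'd cmat"
  assumes "unital \<Phi>" and "a < real CARD('d)"
  shows "unital (Lambda_minus a \<Phi>)"
proof -
  let ?c = "complex_of_real (1 / (real CARD('d) - a))"
  have "trace (mat 1 :: 'd cmat) = complex_of_real (real CARD('d))"
    by (simp add: trace_def mat_def)
  then have "Lambda_minus a \<Phi> (mat 1) = (?c * complex_of_real (real CARD('d) - a)) *\<^sub>M mat 1"
    using assms(1) by (simp add: unital_def Lambda_minus_def vec_eq_iff flip: left_diff_distrib)
  also have "?c * complex_of_real (real CARD('d) - a) = 1"
    using assms(2) by (subst of_real_mult[symmetric]) simp
  finally show ?thesis
    by (simp add: unital_def vec_eq_iff)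
qed

text \<open>The choice of \<open>M\<close> is \<open>Tr\<^sub>2(X) / d\<close>.\<close>

lemma partial_trace_free_decomposition:
  fixes X :: "('k::finite \<times> 'd::finite) cmat"
  obtains Z and M :: "'k cmat" where "X = Z + tensor_one M" and "ampl trace_one Z = 0"
proof
  let ?M = "(\<chi> i j. trace (block X i j) / of_nat CARD('d)) :: 'k cmat"
  show "X = (X - tensor_one ?M) + tensor_one ?M" by simp
  have "block (X - tensor_one ?M) i j
      = block X i j + (- trace (block X i j) / of_nat CARD('d)) *\<^sub>M mat 1" for i j
    by (simp add: vec_eq_iff block_def tensor_one_def mat_def)
  then have "trace (block (X - tensor_one ?M) i j) = 0" for i j
    by (simp add: trace_add_complex trace_mscale) (simp add: trace_def mat_def)
  then show "ampl trace_one (X - tensor_one ?M) = 0"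
    by (simp add: vec_eq_iff ampl_nth trace_one_def)
qed

theorem theorem3p2:
  fixes \<Phi> :: "('d::finite) cmat \<Rightarrow> 'd cmat" and a :: real
  assumes "CARD('k::finite) \<le> CARD('d)"
    and "complex_linear \<Phi>"
    and "k_positive TYPE('k) \<Phi>"
    and "unital \<Phi>"
    and "trace_preserving \<Phi>"
    and "\<And>X :: ('k \<times> 'd) cmat.
      ampl depolarizing (conj_transpose (ampl \<Phi> X) ** ampl \<Phi> X)
        \<preceq> ampl depolarizing (conj_transpose X ** X)"
    and "0 \<le> a"
    and "a \<le> real CARD('d) / (real CARD('k) * real CARD('d) + 1)"
  shows "k_Kadison_Schwarz TYPE('k) (Lambda_minus a \<Phi>)"
proof -
  let ?d = "real CARD('d)" and ?k = "real CARD('k)"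
  let ?T = "ampl trace_one :: ('k \<times> 'd) cmat \<Rightarrow> _" and ?F = "ampl \<Phi> :: ('k \<times> 'd) cmat \<Rightarrow> _"
  let ?\<Psi> = "Lambda_minus a \<Phi>"
  define s where "s = ?d - a"
  have "0 < ?d * ?k"
    by simp
  have a_le: "a * (?k * ?d + 1) \<le> ?d"
    using assms(8) \<open>0 < ?d * ?k\<close> by (simp add: pos_le_divide_eq mult.commute add_pos_pos)
  have "a < ?d"
  proof (cases "a = 0")
    case False
    then have "a < a * (?k * ?d + 1)" using assms(7) \<open>0 < ?d * ?k\<close> by (simp add: algebra_simps)
    then show ?thesis using a_le by simp
  qed simp
  then have s: "s > 0" by (simp add: s_def)
  have star: "?F (conj_transpose X) = conj_transpose (?F X)" for X
    using k_positive_conj_transpose assms by blast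
  have "conj_transpose (ampl ?\<Psi> X) ** ampl ?\<Psi> X \<preceq> ampl ?\<Psi> (conj_transpose X ** X)"
    for X :: "('k \<times> 'd) cmat"
  proof -
    obtain Z and M :: "'k cmat" where X: "X = Z + tensor_one M" and Z: "?T Z = 0"
      by (rule partial_trace_free_decomposition)
    have TZ_star: "?T (conj_transpose Z) = 0"
      by (simp add: ampl_trace_one_conj_transpose Z vec_eq_iff)
    have \<Psi>_star: "ampl ?\<Psi> (conj_transpose Z) = conj_transpose (ampl ?\<Psi> Z)"
      by (simp add: ampl_Lambda_minus Z TZ_star star vec_eq_iff)
    let ?Y = "conj_transpose Z ** Z" and ?W = "conj_transpose (?F Z) ** ?F Z"
    have T_psd: "psd (?T ?Y)"
      by (intro psd_ampl_trace_one psd_conj_transpose_mult)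
    \<comment> \<open>The reduction inequality is applied to the image \<open>\<Phi>\<^sub>k(Z\<^sup>*Z)\<close>, whose partial trace is that
      of \<open>Z\<^sup>*Z\<close> because \<open>\<Phi>\<close> preserves the trace.\<close>
    have "psd (?F ?Y)"
      using assms(3) psd_conj_transpose_mult unfolding k_positive_def by blast
    then have F_le: "psd (complex_of_real ?k *\<^sub>M ?T ?Y - ?F ?Y)"
      using reduction_psd[of "?F ?Y"] by (simp add: ampl_trace_one_trace_preserving[OF assms(5)])
    \<comment> \<open>The hypothesis on \<open>\<Delta>\<^sub>k\<close>, multiplied by \<open>d\<close>.\<close>
    have "?T ?Y - ?T ?W = complex_of_real ?d *\<^sub>M (ampl depolarizing ?Y - ampl depolarizing ?W)"
      by (simp add: ampl_depolarizing vec_eq_iff algebra_simps)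
    then have T_le: "psd (?T ?Y - ?T ?W)"
      using assms(6)[of Z] psd_mscale[of _ ?d] by (simp add: psd_le_def)
    have "psd ((of_nat CARD('k) *\<^sub>M ?T ?W - ?W) + complex_of_real ?k *\<^sub>M (?T ?Y - ?T ?W))"
      by (intro psd_add reduction_psd psd_mscale T_le psd_conj_transpose_mult) simp
    then have W_le: "psd (complex_of_real ?k *\<^sub>M ?T ?Y - ?W)"
      by (simp add: mscale_diff_right)
    \<comment> \<open>The coefficient of \<open>Tr\<^sub>2(Z\<^sup>*Z) \<otimes> \<one>\<close> left after both inequalities are used; it is
      nonnegative exactly under the assumed upper bound on \<open>a\<close>.\<close>
    define rest where "rest = (?d - a * (?k * ?d + 1)) / s\<^sup>2"
    have rest: "rest \<ge> 0"
      using a_le by (simp add: rest_def)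
    have coeff: "1 / s = a / s * ?k + (a / s)\<^sup>2 * ?k + rest"
    proof -
      have "s = a * s * ?k + a\<^sup>2 * ?k + (?d - a * (?k * ?d + 1))"
        by (simp add: s_def power2_eq_square algebra_simps)
      then have "s / s\<^sup>2 = (a * s * ?k + a\<^sup>2 * ?k + (?d - a * (?k * ?d + 1))) / s\<^sup>2"
        by simp
      then show ?thesis
        using s by (simp add: rest_def add_divide_distrib power_divide power2_eq_square)
    qed
    have \<Psi>Z: "ampl ?\<Psi> Z = complex_of_real (- (a / s)) *\<^sub>M ?F Z"
      by (simp add: ampl_Lambda_minus Z s_def vec_eq_iff)
    have \<Psi>W: "conj_transpose (ampl ?\<Psi> Z) ** ampl ?\<Psi> Z = complex_of_real ((a / s)\<^sup>2) *\<^sub>M ?W"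
      unfolding \<Psi>Z conj_transpose_mscale mscale_mult_left mscale_mult_right mscale_mscale
      by (simp add: power2_eq_square)
    have \<Psi>Y: "ampl ?\<Psi> ?Y = complex_of_real (1 / s) *\<^sub>M ?T ?Y - complex_of_real (a / s) *\<^sub>M ?F ?Y"
      by (simp add: ampl_Lambda_minus s_def vec_eq_iff right_diff_distrib)
    have "ampl ?\<Psi> ?Y - conj_transpose (ampl ?\<Psi> Z) ** ampl ?\<Psi> Z
        = complex_of_real (a / s) *\<^sub>M (complex_of_real ?k *\<^sub>M ?T ?Y - ?F ?Y)
          + complex_of_real ((a / s)\<^sup>2) *\<^sub>M (complex_of_real ?k *\<^sub>M ?T ?Y - ?W)
          + complex_of_real rest *\<^sub>M ?T ?Y"
      unfolding \<Psi>Y \<Psi>W coeff by (simp add: vec_eq_iff algebra_simps)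
    moreover have "psd \<dots>"
      using assms(7) s rest by (intro psd_add psd_mscale F_le W_le T_psd) simp_all
    ultimately show ?thesis
      unfolding psd_le_def
      using Kadison_Schwarz_deficit_shift[OF complex_linear_Lambda_minus[OF assms(2)]
          unital_Lambda_minus[OF assms(4) \<open>a < ?d\<close>] \<Psi>_star X]
      by simp
  qed
  then show ?thesis
    unfolding k_Kadison_Schwarz_def
    using complex_linear_Lambda_minus[OF assms(2)] unital_Lambda_minus[OF assms(4) \<open>a < ?d\<close>]
    by blast
qed

end
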